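(* Let $k\ge 1$ and let $\Lambda$ be a row-finite $k$-graph with no sources. Then the following are equivalent. (i) $\Lambda$ satisfies the aperiodicity condition: for every $v\in\Lambda^0$ there is $x\in v\Lambda^\infty$ such that $\sigma^m(x)\neq\sigma^n(x)$ for all $m\neq n\in\mathbb{N}^k$. (ii) $\Lambda$ satisfies Condition (B): for every $v\in\Lambda^0$ there is $x\in v\Lambda^\infty$ such that $\mu x\neq\nu x$ for all $\mu\neq\nu\in\Lambda v$. (iii) $\Lambda$ has no local periodicity: for each $v\in\Lambda^0$ and each $m\neq n\in\mathbb{N}^k$ there exists $x\in v\Lambda^\infty$ such that $\sigma^m(x)\neq\sigma^n(x)$. (iv) For each vertex $v\in\Lambda^0$ and each pair $m\neq n\in\mathbb{N}^k$ there is a path $\lambda=\lambda_{v,m,n}\in v\Lambda$ such that $d(\lambda)\ge m\vee n$ and $$\lambda\big(m,\,m+d(\lambda)-(m\vee n)\big)\neq\lambda\big(n,\,n+d(\lambda)-(m\vee n)\big).$$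
   Context: $\mathbb{N}=\{0,1,2,\dots\}$; $\mathbb{N}^k$ is a monoid under addition, ordered coordinatewise; $m\vee n$ is the coordinatewise maximum. A $k$-graph is a countable small category $\Lambda$ (whose morphisms are called paths) with a functor $d:\Lambda\to\mathbb{N}^k$ (the degree) having the factorisation property: if $d(\lambda)=m+n$ there are unique $\mu\in d^{-1}(m)$ and $\nu\in d^{-1}(n)$ with $\lambda=\mu\nu$. Write $\Lambda^n=d^{-1}(n)$; the vertices are the elements of $\Lambda^0$ (identified with the objects). Each path $\lambda$ has a range $r(\lambda)$ and source $s(\lambda)$ in $\Lambda^0$ with $r(\lambda)\lambda=\lambda=\lambda s(\lambda)$, and $\mu\nu$ is defined when $s(\mu)=r(\nu)$. For $v\in\Lambda^0$ and $E\subseteq\Lambda$, $vE=\{\lambda\in E: r(\lambda)=v\}$ and $Ev=\{\lambda\in E:s(\lambda)=v\}$. If $d(\lambda)=l$ and $0\le m\le n\le l$, then $\lambda(0,m)\in\Lambda^m$, $\lambda(m,n)\in\Lambda^{n-m}$, $\lambda(n,l)\in\Lambda^{l-n}$ are the unique paths with $\lambda=\lambda(0,m)\lambda(m,n)\lambda(n,l)$. $\Lambda$ is row-finite if $v\Lambda^n$ is finite for all $v\in\Lambda^0$, $n\in\mathbb{N}^k$, and has no sources if $v\Lambda^n$ is always nonempty. $\Omega_k$ is the $k$-graph with paths $\{(m,n)\in\mathbb{N}^k\times\mathbb{N}^k:m\le n\}$, $r(m,n)=(m,m)$, $s(m,n)=(n,n)$, $(m,n)(n,p)=(m,p)$, $d(m,n)=n-m$;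 the vertex $(n,n)$ is written $n$. An infinite path in $\Lambda$ is a degree-preserving functor $x:\Omega_k\to\Lambda$; $\Lambda^\infty$ is the set of all infinite paths, $r(x)=x(0)$, and $v\Lambda^\infty=\{x\in\Lambda^\infty:r(x)=v\}$. For $p\in\mathbb{N}^k$, the shift $\sigma^p:\Lambda^\infty\to\Lambda^\infty$ is $\sigma^p(x)(m,n)=x(m+p,n+p)$. For $\mu\in\Lambda$ and $x\in s(\mu)\Lambda^\infty$, $\mu x$ is the unique infinite path with $(\mu x)(0,d(\mu))=\mu$ and $\sigma^{d(\mu)}(\mu x)=x$. *)

theory Defs
  imports "HOL-Analysis.Finite_Cartesian_Product" "HOL-Library.FuncSet"
    "HOL-Library.Countable_Set"
begin

text \<open>The monoid of k-tuples of natural numbers is the type \<open>nat ^ 'k\<close> with \<open>'k\<close> finite (hence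
  nonempty, so that \<open>k = CARD('k) \<ge> 1\<close>). Addition and order are the library's coordinatewise ones.
  Subtraction is also coordinatewise, hence truncated; below \<open>n - m\<close> only matters for \<open>m \<le> n\<close>.
  The library's \<open>sup\<close> on vectors is not available for \<open>nat\<close> components.\<close>

definition vmax :: "nat ^ 'k \<Rightarrow> nat ^ 'k \<Rightarrow> nat ^ 'k" where
  "vmax m n = (\<chi> i. max (m $ i) (n $ i))"

record ('a, 'k) kgraph =
  paths :: "'a set"
  rng :: "'a \<Rightarrow> 'a"
  src :: "'a \<Rightarrow> 'a"
  pcomp :: "'a \<Rightarrow> 'a \<Rightarrow> 'a"
  deg :: "'a \<Rightarrow> nat ^ 'k"

definition paths_of_degree :: "('a, 'k::finite) kgraph \<Rightarrow> nat ^ 'k \<Rightarrow> 'a set" where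
  "paths_of_degree \<Lambda> n = {\<xi> \<in> paths \<Lambda>. deg \<Lambda> \<xi> = n}"

definition vertices :: "('a, 'k::finite) kgraph \<Rightarrow> 'a set" where
  "vertices \<Lambda> = paths_of_degree \<Lambda> 0"

definition paths_to :: "('a, 'k::finite) kgraph \<Rightarrow> 'a \<Rightarrow> 'a set \<Rightarrow> 'a set" where
  "paths_to \<Lambda> v E = {\<xi> \<in> E. rng \<Lambda> \<xi> = v}"

definition paths_from :: "('a, 'k::finite) kgraph \<Rightarrow> 'a set \<Rightarrow> 'a \<Rightarrow> 'a set" where
  "paths_from \<Lambda> E v = {\<xi> \<in> E. src \<Lambda> \<xi> = v}"

text \<open>Small categories in the arrows-only presentation: each object is identified with its identity
  morphism, so \<open>rng\<close> and \<open>src\<close> send a morphism to the identities at its codomain and domain.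
  The product \<open>pcomp \<Lambda> \<mu> \<nu>\<close> is meaningful when \<open>src \<Lambda> \<mu> = rng \<Lambda> \<nu>\<close>.\<close>

locale small_category =
  fixes \<Lambda> :: "('a, 'k::finite) kgraph"
  assumes rng_closed: "\<mu> \<in> paths \<Lambda> \<Longrightarrow> rng \<Lambda> \<mu> \<in> paths \<Lambda>"
    and src_closed: "\<mu> \<in> paths \<Lambda> \<Longrightarrow> src \<Lambda> \<mu> \<in> paths \<Lambda>"
    and src_rng: "\<mu> \<in> paths \<Lambda> \<Longrightarrow> src \<Lambda> (rng \<Lambda> \<mu>) = rng \<Lambda> \<mu>"
    and rng_src: "\<mu> \<in> paths \<Lambda> \<Longrightarrow> rng \<Lambda> (src \<Lambda> \<mu>) = src \<Lambda> \<mu>"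
    and comp_closed: "\<lbrakk>\<mu> \<in> paths \<Lambda>; \<nu> \<in> paths \<Lambda>; src \<Lambda> \<mu> = rng \<Lambda> \<nu>\<rbrakk>
          \<Longrightarrow> pcomp \<Lambda> \<mu> \<nu> \<in> paths \<Lambda>"
    and rng_comp: "\<lbrakk>\<mu> \<in> paths \<Lambda>; \<nu> \<in> paths \<Lambda>; src \<Lambda> \<mu> = rng \<Lambda> \<nu>\<rbrakk>
          \<Longrightarrow> rng \<Lambda> (pcomp \<Lambda> \<mu> \<nu>) = rng \<Lambda> \<mu>"
    and src_comp: "\<lbrakk>\<mu> \<in> paths \<Lambda>; \<nu> \<in> paths \<Lambda>; src \<Lambda> \<mu> = rng \<Lambda> \<nu>\<rbrakk>
          \<Longrightarrow> src \<Lambda> (pcomp \<Lambda> \<mu> \<nu>) = src \<Lambda> \<nu>"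
    and comp_assoc: "\<lbrakk>\<mu> \<in> paths \<Lambda>; \<nu> \<in> paths \<Lambda>; \<xi> \<in> paths \<Lambda>;
          src \<Lambda> \<mu> = rng \<Lambda> \<nu>; src \<Lambda> \<nu> = rng \<Lambda> \<xi>\<rbrakk>
          \<Longrightarrow> pcomp \<Lambda> (pcomp \<Lambda> \<mu> \<nu>) \<xi> = pcomp \<Lambda> \<mu> (pcomp \<Lambda> \<nu> \<xi>)"
    and rng_left_unit: "\<mu> \<in> paths \<Lambda> \<Longrightarrow> pcomp \<Lambda> (rng \<Lambda> \<mu>) \<mu> = \<mu>"
    and src_right_unit: "\<mu> \<in> paths \<Lambda> \<Longrightarrow> pcomp \<Lambda> \<mu> (src \<Lambda> \<mu>) = \<mu>"

text \<open>\<open>deg_id\<close> and \<open>deg_comp\<close> say that the degree is a functor into the one-object category given by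
  the additive monoid; by \<open>rng_src\<close> every identity is of the form \<open>rng \<Lambda> \<mu>\<close>.\<close>

locale k_graph = small_category \<Lambda> for \<Lambda> :: "('a, 'k::finite) kgraph" +
  assumes countable_paths: "countable (paths \<Lambda>)"
    and deg_id: "\<mu> \<in> paths \<Lambda> \<Longrightarrow> deg \<Lambda> (rng \<Lambda> \<mu>) = 0"
    and deg_comp: "\<lbrakk>\<mu> \<in> paths \<Lambda>; \<nu> \<in> paths \<Lambda>; src \<Lambda> \<mu> = rng \<Lambda> \<nu>\<rbrakk>
          \<Longrightarrow> deg \<Lambda> (pcomp \<Lambda> \<mu> \<nu>) = deg \<Lambda> \<mu> + deg \<Lambda> \<nu>"
    and factorisation: "\<lbrakk>\<xi> \<in> paths \<Lambda>; deg \<Lambda> \<xi> = m + n\<rbrakk>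
          \<Longrightarrow> \<exists>!(\<mu>, \<nu>). \<mu> \<in> paths_of_degree \<Lambda> m \<and> \<nu> \<in> paths_of_degree \<Lambda> n \<and>
                src \<Lambda> \<mu> = rng \<Lambda> \<nu> \<and> \<xi> = pcomp \<Lambda> \<mu> \<nu>"
begin

lemma factorisation_unique:
  assumes "\<mu> \<in> paths_of_degree \<Lambda> m" "\<nu> \<in> paths_of_degree \<Lambda> n" "src \<Lambda> \<mu> = rng \<Lambda> \<nu>"
    and "\<mu>' \<in> paths_of_degree \<Lambda> m" "\<nu>' \<in> paths_of_degree \<Lambda> n" "src \<Lambda> \<mu>' = rng \<Lambda> \<nu>'"
    and eq: "pcomp \<Lambda> \<mu> \<nu> = pcomp \<Lambda> \<mu>' \<nu>'"
  shows "\<mu> = \<mu>' \<and> \<nu> = \<nu>'"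
proof -
  have "pcomp \<Lambda> \<mu> \<nu> \<in> paths \<Lambda>" "deg \<Lambda> (pcomp \<Lambda> \<mu> \<nu>) = m + n"
    using assms(1-3) by (auto simp: paths_of_degree_def comp_closed deg_comp)
  from factorisation[OF this] obtain p where "\<forall>q. (case q of (\<alpha>, \<beta>) \<Rightarrow> \<alpha> \<in> paths_of_degree \<Lambda> m \<and>
      \<beta> \<in> paths_of_degree \<Lambda> n \<and> src \<Lambda> \<alpha> = rng \<Lambda> \<beta> \<and> pcomp \<Lambda> \<mu> \<nu> = pcomp \<Lambda> \<alpha> \<beta>) \<longrightarrow> q = p"
    by (elim ex1E) blast
  from this[rule_format, of "(\<mu>, \<nu>)"] this[rule_format, of "(\<mu>', \<nu>')"]
  have "(\<mu>, \<nu>) = p" "(\<mu>', \<nu>') = p" using assms by simp_all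
  then show ?thesis by blast
qed

lemma vertices_eq_identities: "vertices \<Lambda> = rng \<Lambda> ` paths \<Lambda>"
proof
  show "rng \<Lambda> ` paths \<Lambda> \<subseteq> vertices \<Lambda>"
    by (auto simp: vertices_def paths_of_degree_def rng_closed deg_id)
next
  show "vertices \<Lambda> \<subseteq> rng \<Lambda> ` paths \<Lambda>"
  proof
    fix v assume "v \<in> vertices \<Lambda>"
    then have v: "v \<in> paths \<Lambda>" "deg \<Lambda> v = 0 + 0"
      by (auto simp: vertices_def paths_of_degree_def)
    have s: "src \<Lambda> v \<in> paths \<Lambda>" "deg \<Lambda> (src \<Lambda> v) = 0"
      using deg_id[OF src_closed[OF v(1)]] by (auto simp: rng_src v src_closed)
    have "v = rng \<Lambda> v \<and> src \<Lambda> v = v"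
      by (rule factorisation_unique[of _ 0 _ 0])
        (use v s in \<open>simp_all add: paths_of_degree_def rng_src src_rng rng_closed deg_id
          src_right_unit rng_left_unit\<close>)
    then show "v \<in> rng \<Lambda> ` paths \<Lambda>" using v(1) by (metis imageI)
  qed
qed

end

definition row_finite :: "('a, 'k::finite) kgraph \<Rightarrow> bool" where
  "row_finite \<Lambda> \<longleftrightarrow> (\<forall>v \<in> vertices \<Lambda>. \<forall>n. finite (paths_to \<Lambda> v (paths_of_degree \<Lambda> n)))"

definition no_sources :: "('a, 'k::finite) kgraph \<Rightarrow> bool" where
  "no_sources \<Lambda> \<longleftrightarrow> (\<forall>v \<in> vertices \<Lambda>. \<forall>n. paths_to \<Lambda> v (paths_of_degree \<Lambda> n) \<noteq> {})"

text \<open>\<open>segment \<Lambda> \<xi> m n\<close> is the middle factor \<open>\<xi>(m,n)\<close>, meaningful for \<open>m \<le> n \<le> deg \<Lambda> \<xi>\<close>.\<close>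

definition segment :: "('a, 'k::finite) kgraph \<Rightarrow> 'a \<Rightarrow> nat ^ 'k \<Rightarrow> nat ^ 'k \<Rightarrow> 'a" where
  "segment \<Lambda> \<xi> m n = (THE \<mu>. \<mu> \<in> paths_of_degree \<Lambda> (n - m) \<and>
     (\<exists>\<alpha> \<in> paths_of_degree \<Lambda> m. \<exists>\<beta> \<in> paths_of_degree \<Lambda> (deg \<Lambda> \<xi> - n).
        src \<Lambda> \<alpha> = rng \<Lambda> \<mu> \<and> src \<Lambda> \<mu> = rng \<Lambda> \<beta> \<and>
        \<xi> = pcomp \<Lambda> (pcomp \<Lambda> \<alpha> \<mu>) \<beta>))"

lemma (in k_graph) segment_unique:
  assumes "\<xi> \<in> paths \<Lambda>" and mn: "m \<le> n" and nd: "n \<le> deg \<Lambda> \<xi>"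
  shows "\<exists>!\<mu>. \<mu> \<in> paths_of_degree \<Lambda> (n - m) \<and>
     (\<exists>\<alpha> \<in> paths_of_degree \<Lambda> m. \<exists>\<beta> \<in> paths_of_degree \<Lambda> (deg \<Lambda> \<xi> - n).
        src \<Lambda> \<alpha> = rng \<Lambda> \<mu> \<and> src \<Lambda> \<mu> = rng \<Lambda> \<beta> \<and>
        \<xi> = pcomp \<Lambda> (pcomp \<Lambda> \<alpha> \<mu>) \<beta>)" (is "\<exists>!\<mu>. ?P \<mu>")
proof -
  let ?l = "deg \<Lambda> \<xi>"
  have d1: "deg \<Lambda> \<xi> = n + (?l - n)" and d2: "n = m + (n - m)"
    using mn nd by (auto simp: vec_eq_iff less_eq_vec_def)
  obtain \<theta> \<beta> where \<theta>: "\<theta> \<in> paths_of_degree \<Lambda> n" "\<beta> \<in> paths_of_degree \<Lambda> (?l - n)"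
      "src \<Lambda> \<theta> = rng \<Lambda> \<beta>" "\<xi> = pcomp \<Lambda> \<theta> \<beta>"
    using ex1_implies_ex[OF factorisation[OF assms(1) d1]] by (auto simp del: prod.inject)
  have \<theta>_paths: "\<theta> \<in> paths \<Lambda>" "deg \<Lambda> \<theta> = m + (n - m)"
    using \<theta>(1) d2 by (auto simp: paths_of_degree_def)
  obtain \<alpha> \<mu> where \<mu>: "\<alpha> \<in> paths_of_degree \<Lambda> m" "\<mu> \<in> paths_of_degree \<Lambda> (n - m)"
      "src \<Lambda> \<alpha> = rng \<Lambda> \<mu>" "\<theta> = pcomp \<Lambda> \<alpha> \<mu>"
    using ex1_implies_ex[OF factorisation[OF \<theta>_paths]] by auto
  show ?thesis
  proof (rule ex1I[of _ \<mu>])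
    show "?P \<mu>"
    proof (intro conjI bexI)
      show "src \<Lambda> \<mu> = rng \<Lambda> \<beta>"
        using \<theta>(3) \<mu> src_comp[of \<alpha> \<mu>] by (simp add: paths_of_degree_def)
      show "\<xi> = pcomp \<Lambda> (pcomp \<Lambda> \<alpha> \<mu>) \<beta>" using \<theta>(4) \<mu>(4) by simp
    qed (fact \<mu> \<theta>)+
  next
    fix \<mu>' assume \<mu>': "?P \<mu>'"
    then obtain \<alpha>' \<beta>' where *: "\<alpha>' \<in> paths_of_degree \<Lambda> m"
        "\<mu>' \<in> paths_of_degree \<Lambda> (n - m)" "\<beta>' \<in> paths_of_degree \<Lambda> (?l - n)"
        "src \<Lambda> \<alpha>' = rng \<Lambda> \<mu>'" "src \<Lambda> \<mu>' = rng \<Lambda> \<beta>'"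
        "\<xi> = pcomp \<Lambda> (pcomp \<Lambda> \<alpha>' \<mu>') \<beta>'"
      by blast
    have "pcomp \<Lambda> \<alpha>' \<mu>' \<in> paths_of_degree \<Lambda> n" "src \<Lambda> (pcomp \<Lambda> \<alpha>' \<mu>') = rng \<Lambda> \<beta>'"
      using * d2 by (auto simp: paths_of_degree_def comp_closed deg_comp src_comp)
    then have "pcomp \<Lambda> \<alpha>' \<mu>' = \<theta>"
      using factorisation_unique[OF _ *(3) _ \<theta>(1-3)] * \<theta>(4) by metis
    then show "\<mu>' = \<mu>" using factorisation_unique[OF *(1,2,4) \<mu>(1-3)] \<mu>(4) by metis
  qed
qed

definition Omega :: "((nat ^ 'k) \<times> (nat ^ 'k), 'k::finite) kgraph" where
  "Omega = \<lparr>paths = {(m, n). m \<le> n},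
            rng = (\<lambda>(m, n). (m, m)),
            src = (\<lambda>(m, n). (n, n)),
            pcomp = (\<lambda>(m, n) (n', p). (m, p)),
            deg = (\<lambda>(m, n). n - m)\<rparr>"

lemma k_graph_Omega: "k_graph (Omega :: (_, 'k::finite) kgraph)"
proof unfold_locales
  show "\<exists>!(\<mu>, \<nu>). \<mu> \<in> paths_of_degree Omega m \<and> \<nu> \<in> paths_of_degree Omega n \<and>
          src Omega \<mu> = rng Omega \<nu> \<and> \<xi> = pcomp Omega \<mu> \<nu>"
    if "\<xi> \<in> paths Omega" "deg Omega \<xi> = m + n" for \<xi> and m n :: "nat ^ 'k"
  proof -
    obtain a b where ab: "\<xi> = (a, b)" by (cases \<xi>)
    have *: "\<And>i. a $ i \<le> b $ i" "\<And>i. b $ i - a $ i = m $ i + n $ i"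
      using that by (auto simp: ab Omega_def less_eq_vec_def vec_eq_iff)
    have b: "b $ i = a $ i + m $ i + n $ i" for i
      using *[of i] by simp
    have u: "x = a + m" if "\<forall>i. a $ i \<le> x $ i" "\<forall>i. x $ i - a $ i = m $ i" for x :: "nat ^ 'k"
      using that by (simp add: vec_eq_iff) (metis le_add_diff_inverse)
    have le: "a \<le> a + m" "a + m \<le> b" "b - (a + m) = n" "a + m - a = m"
      by (auto simp: less_eq_vec_def vec_eq_iff b)
    show ?thesis
    proof (rule ex1I[of _ "((a, a + m), (a + m, b))"])
      fix q assume q: "case q of (\<mu>, \<nu>) \<Rightarrow> \<mu> \<in> paths_of_degree Omega m \<and>
        \<nu> \<in> paths_of_degree Omega n \<and> src Omega \<mu> = rng Omega \<nu> \<and> \<xi> = pcomp Omega \<mu> \<nu>"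
      obtain c x y z where q_eq: "q = ((c, x), (y, z))" by (metis prod.exhaust)
      have "c = a" "y = x" "z = b" "a \<le> x" "x - a = m"
        using q by (auto simp: q_eq ab Omega_def paths_of_degree_def)
      moreover from this have "x = a + m"
        using u[of x] by (auto simp: less_eq_vec_def)
      ultimately show "q = ((a, a + m), (a + m, b))" by (simp add: q_eq)
    qed (simp add: ab Omega_def paths_of_degree_def le)
  qed
next
  show "deg Omega (pcomp Omega \<mu> \<nu>) = deg Omega \<mu> + deg Omega \<nu>"
    if "\<mu> \<in> paths Omega" "\<nu> \<in> paths Omega" "src Omega \<mu> = rng Omega \<nu>"
    for \<mu> \<nu> :: "(nat ^ 'k) \<times> (nat ^ 'k)"
    using that by (auto simp: Omega_def less_eq_vec_def vec_eq_iff)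
next
  show "pcomp Omega \<mu> \<nu> \<in> paths Omega"
    if "\<mu> \<in> paths Omega" "\<nu> \<in> paths Omega" "src Omega \<mu> = rng Omega \<nu>"
    for \<mu> \<nu> :: "(nat ^ 'k) \<times> (nat ^ 'k)"
    using that by (auto simp: Omega_def)
next
  show "deg Omega (rng Omega \<mu>) = 0" for \<mu> :: "(nat ^ 'k) \<times> (nat ^ 'k)"
    by (cases \<mu>) (simp add: Omega_def vec_eq_iff)
qed (auto simp: Omega_def)

text \<open>The functors are taken to be \<open>extensional\<close>, so that equality of functors is HOL equality.
  Since objects are identity morphisms, preservation of identities is part of preservation of
  \<open>rng\<close> and \<open>src\<close>.\<close>

definition degree_preserving_functors ::
    "('b, 'k::finite) kgraph \<Rightarrow> ('a, 'k) kgraph \<Rightarrow> ('b \<Rightarrow> 'a) set" where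
  "degree_preserving_functors \<Gamma> \<Lambda> = {x \<in> paths \<Gamma> \<rightarrow>\<^sub>E paths \<Lambda>.
     (\<forall>\<mu> \<in> paths \<Gamma>. x (rng \<Gamma> \<mu>) = rng \<Lambda> (x \<mu>) \<and> x (src \<Gamma> \<mu>) = src \<Lambda> (x \<mu>) \<and>
        deg \<Lambda> (x \<mu>) = deg \<Gamma> \<mu>) \<and>
     (\<forall>\<mu> \<in> paths \<Gamma>. \<forall>\<nu> \<in> paths \<Gamma>. src \<Gamma> \<mu> = rng \<Gamma> \<nu> \<longrightarrow>
        x (pcomp \<Gamma> \<mu> \<nu>) = pcomp \<Lambda> (x \<mu>) (x \<nu>))}"

type_synonym ('a, 'k) infpath = "(nat ^ 'k) \<times> (nat ^ 'k) \<Rightarrow> 'a"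

definition infinite_paths :: "('a, 'k::finite) kgraph \<Rightarrow> ('a, 'k) infpath set" where
  "infinite_paths \<Lambda> = degree_preserving_functors Omega \<Lambda>"

definition infinite_paths_to :: "('a, 'k::finite) kgraph \<Rightarrow> 'a \<Rightarrow> ('a, 'k) infpath set" where
  "infinite_paths_to \<Lambda> v = {x \<in> infinite_paths \<Lambda>. x (0, 0) = v}"

definition shift :: "nat ^ 'k \<Rightarrow> ('a, 'k::finite) infpath \<Rightarrow> ('a, 'k) infpath" where
  "shift p x = (\<lambda>(m, n) \<in> paths Omega. x (m + p, n + p))"

text \<open>\<open>prepend \<Lambda> \<mu> x\<close> is \<open>\<mu>x\<close>, meaningful for \<open>x \<in> infinite_paths_to \<Lambda> (src \<Lambda> \<mu>)\<close>.\<close>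

definition prepend :: "('a, 'k::finite) kgraph \<Rightarrow> 'a \<Rightarrow> ('a, 'k) infpath \<Rightarrow> ('a, 'k) infpath" where
  "prepend \<Lambda> \<mu> x =
     (THE y. y \<in> infinite_paths \<Lambda> \<and> y (0, deg \<Lambda> \<mu>) = \<mu> \<and> shift (deg \<Lambda> \<mu>) y = x)"

definition aperiodicity_condition :: "('a, 'k::finite) kgraph \<Rightarrow> bool" where
  "aperiodicity_condition \<Lambda> \<longleftrightarrow> (\<forall>v \<in> vertices \<Lambda>. \<exists>x \<in> infinite_paths_to \<Lambda> v.
     \<forall>m n. m \<noteq> n \<longrightarrow> shift m x \<noteq> shift n x)"

definition condition_B :: "('a, 'k::finite) kgraph \<Rightarrow> bool" where
  "condition_B \<Lambda> \<longleftrightarrow> (\<forall>v \<in> vertices \<Lambda>. \<exists>x \<in> infinite_paths_to \<Lambda> v.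
     \<forall>\<mu> \<in> paths_from \<Lambda> (paths \<Lambda>) v. \<forall>\<nu> \<in> paths_from \<Lambda> (paths \<Lambda>) v.
       \<mu> \<noteq> \<nu> \<longrightarrow> prepend \<Lambda> \<mu> x \<noteq> prepend \<Lambda> \<nu> x)"

definition no_local_periodicity :: "('a, 'k::finite) kgraph \<Rightarrow> bool" where
  "no_local_periodicity \<Lambda> \<longleftrightarrow> (\<forall>v \<in> vertices \<Lambda>. \<forall>m n. m \<noteq> n \<longrightarrow>
     (\<exists>x \<in> infinite_paths_to \<Lambda> v. shift m x \<noteq> shift n x))"

end

theory Submission
  imports Defs
begin

text \<open>
  The proof runs round the cycle (i) \<open>\<Longrightarrow>\<close> (ii) \<open>\<Longrightarrow>\<close> (iii) \<open>\<Longrightarrow>\<close> (iv) \<open>\<Longrightarrow>\<close> (i). Two facts about infinite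
  paths carry it. An infinite path is determined by arbitrarily long initial segments
  (\<open>infinite_path_eqI\<close>), and conversely every chain of finite paths, each extending the one before and
  with degrees cofinal in \<open>nat ^ 'k\<close>, is the chain of initial segments of an infinite path
  (\<open>infinite_path_of_chain\<close>). Together they make \<open>prepend \<Lambda> \<mu> x\<close> well defined (\<open>prepend_works\<close>,
  \<open>prepend_eqI\<close>).

  (i) \<open>\<Longrightarrow>\<close> (ii): if \<open>\<mu>x = \<nu>x\<close>, then removing an initial segment of degree \<open>d(\<mu>) + d(\<nu>)\<close> gives
  \<open>\<sigma>\<close>-shifts of \<open>x\<close> by \<open>d(\<nu>)\<close> and by \<open>d(\<mu>)\<close>, so aperiodicity of \<open>x\<close> forces \<open>d(\<mu>) = d(\<nu>)\<close>, and
  then \<open>\<mu>\<close> and \<open>\<nu>\<close> are the same initial segment.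

  (ii) \<open>\<Longrightarrow>\<close> (iii): if all infinite paths \<open>y\<close> at \<open>v\<close> had equal shifts by \<open>m\<close> and \<open>n\<close>, take a path
  \<open>\<xi>\<close> at \<open>v\<close> of degree \<open>vmax m n\<close>. For every \<open>x\<close> at the source of \<open>\<xi>\<close>, comparing the two shifts of
  \<open>\<xi>x\<close> says that the two tails of \<open>\<xi>\<close> starting at \<open>m\<close> and at \<open>n\<close>, which have different degrees, have
  the same product with \<open>x\<close>. This contradicts Condition (B) at the source of \<open>\<xi>\<close>.

  (iii) \<open>\<Longrightarrow>\<close> (iv): two distinct shifts differ already on an initial segment, so a long enough
  initial segment of \<open>x\<close> witnesses (iv).

  (iv) \<open>\<Longrightarrow>\<close> (i): enumerate all pairs \<open>(m, n)\<close> and build an infinite path at \<open>v\<close> by appending, at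
  each stage, a finite path that distinguishes the current pair. A distinction that occurs after an
  initial segment of degree \<open>p\<close> shows that the shifts by \<open>p + m\<close> and \<open>p + n\<close> differ, hence so do
  those by \<open>m\<close> and \<open>n\<close>.
\<close>

section \<open>Degrees\<close>

lemma vec_le_iff_ex_add: "(m::nat ^ 'k::finite) \<le> n \<longleftrightarrow> (\<exists>d. n = m + d)"
proof
  assume "m \<le> n"
  then have "n = m + (n - m)" by (auto simp: less_eq_vec_def vec_eq_iff)
  then show "\<exists>d. n = m + d" ..
qed (auto simp: less_eq_vec_def)

lemma vec_add_diff: "(m::nat ^ 'k::finite) \<le> n \<Longrightarrow> m + (n - m) = n"
  by (auto simp: less_eq_vec_def vec_eq_iff)

lemma vec_zero_le: "(0::nat ^ 'k::finite) \<le> n"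
  by (auto simp: less_eq_vec_def)

lemma vec_le_add: "(m::nat ^ 'k::finite) \<le> m + n" "(m::nat ^ 'k::finite) \<le> n + m"
  by (auto simp: less_eq_vec_def)

lemma vec_add_mono:
  fixes a b p :: "nat ^ 'k::finite"
  shows "a \<le> b \<Longrightarrow> p + a \<le> p + b" "a \<le> b \<Longrightarrow> a + p \<le> b + p"
  by (auto simp: less_eq_vec_def)

lemma le_vmax: "m \<le> vmax m n" "n \<le> vmax m n"
  by (auto simp: less_eq_vec_def vmax_def)

context k_graph
begin

section \<open>Segments of finite paths\<close>

lemma composite_eqD:
  assumes "\<mu> \<in> paths \<Lambda>" "\<nu> \<in> paths \<Lambda>" "src \<Lambda> \<mu> = rng \<Lambda> \<nu>"
    and "\<mu>' \<in> paths \<Lambda>" "\<nu>' \<in> paths \<Lambda>" "src \<Lambda> \<mu>' = rng \<Lambda> \<nu>'"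
    and "deg \<Lambda> \<mu> = deg \<Lambda> \<mu>'" "pcomp \<Lambda> \<mu> \<nu> = pcomp \<Lambda> \<mu>' \<nu>'"
  shows "\<mu> = \<mu>'" "\<nu> = \<nu>'"
proof -
  have "deg \<Lambda> \<nu> = deg \<Lambda> \<nu>'"
    using deg_comp[OF assms(1-3)] deg_comp[OF assms(4-6)] assms(7,8) by simp
  then have "\<mu> = \<mu>' \<and> \<nu> = \<nu>'"
    using assms by (intro factorisation_unique[of _ "deg \<Lambda> \<mu>" _ "deg \<Lambda> \<nu>"])
      (auto simp: paths_of_degree_def)
  then show "\<mu> = \<mu>'" "\<nu> = \<nu>'" by auto
qed

lemma factorisationE:
  assumes "\<xi> \<in> paths \<Lambda>" "deg \<Lambda> \<xi> = m + n"
  obtains \<mu> \<nu> where "\<mu> \<in> paths \<Lambda>" "\<nu> \<in> paths \<Lambda>" "deg \<Lambda> \<mu> = m" "deg \<Lambda> \<nu> = n"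
    "src \<Lambda> \<mu> = rng \<Lambda> \<nu>" "\<xi> = pcomp \<Lambda> \<mu> \<nu>"
  using ex1_implies_ex[OF factorisation[OF assms]] that by (auto simp: paths_of_degree_def)

lemma segment_eqI:
  assumes "\<alpha> \<in> paths \<Lambda>" "\<mu> \<in> paths \<Lambda>" "\<beta> \<in> paths \<Lambda>" "src \<Lambda> \<alpha> = rng \<Lambda> \<mu>" "src \<Lambda> \<mu> = rng \<Lambda> \<beta>"
    and \<xi>: "\<xi> = pcomp \<Lambda> \<alpha> (pcomp \<Lambda> \<mu> \<beta>)" and m: "m = deg \<Lambda> \<alpha>" and n: "n = deg \<Lambda> \<alpha> + deg \<Lambda> \<mu>"
  shows "segment \<Lambda> \<xi> m n = \<mu>"
proof -
  have \<xi>': "\<xi> = pcomp \<Lambda> (pcomp \<Lambda> \<alpha> \<mu>) \<beta>" using assms by (simp add: comp_assoc)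
  have \<xi>p: "\<xi> \<in> paths \<Lambda>" using assms by (simp add: comp_closed rng_comp)
  have d: "deg \<Lambda> \<xi> = n + deg \<Lambda> \<beta>"
    unfolding \<xi>' n using assms by (simp add: deg_comp comp_closed src_comp)
  have le: "m \<le> n" "n \<le> deg \<Lambda> \<xi>" by (simp_all add: m n d vec_le_add)
  have "n - m = deg \<Lambda> \<mu>" "deg \<Lambda> \<xi> - n = deg \<Lambda> \<beta>" by (simp_all add: d) (simp add: m n)
  then have "\<alpha> \<in> paths_of_degree \<Lambda> m" "\<mu> \<in> paths_of_degree \<Lambda> (n - m)"
    "\<beta> \<in> paths_of_degree \<Lambda> (deg \<Lambda> \<xi> - n)"
    using assms by (simp_all add: paths_of_degree_def)
  with assms(4,5) \<xi>' show ?thesis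
    unfolding segment_def by (intro the1_equality[OF segment_unique[OF \<xi>p le]]) blast
qed

text \<open>A finite path behaves like a functor on the part of \<open>Omega\<close> below its degree; all of it is
  read off from one factorisation of \<open>\<xi>\<close> into four pieces.\<close>

lemma segment_functorial:
  assumes \<xi>: "\<xi> \<in> paths \<Lambda>" and "m \<le> n" "n \<le> p" "p \<le> deg \<Lambda> \<xi>"
  shows segment_closed: "segment \<Lambda> \<xi> m n \<in> paths \<Lambda>"
    and deg_segment: "deg \<Lambda> (segment \<Lambda> \<xi> m n) = n - m"
    and rng_segment: "rng \<Lambda> (segment \<Lambda> \<xi> m n) = segment \<Lambda> \<xi> m m"
    and src_segment: "src \<Lambda> (segment \<Lambda> \<xi> m n) = segment \<Lambda> \<xi> n n"
    and segment_comp: "pcomp \<Lambda> (segment \<Lambda> \<xi> m n) (segment \<Lambda> \<xi> n p) = segment \<Lambda> \<xi> m p"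
proof -
  obtain a b c where n: "n = m + a" and p: "p = n + b" and d: "deg \<Lambda> \<xi> = p + c"
    using assms(2-4) by (auto simp: vec_le_iff_ex_add)
  have "deg \<Lambda> \<xi> = m + (a + (b + c))" by (simp add: n p d add.assoc)
  then obtain \<alpha> \<eta> where \<alpha>: "\<alpha> \<in> paths \<Lambda>" "\<eta> \<in> paths \<Lambda>" "deg \<Lambda> \<alpha> = m" "deg \<Lambda> \<eta> = a + (b + c)"
    "src \<Lambda> \<alpha> = rng \<Lambda> \<eta>" "\<xi> = pcomp \<Lambda> \<alpha> \<eta>"
    using factorisationE[OF \<xi>] by metis
  then obtain \<mu> \<zeta> where \<mu>: "\<mu> \<in> paths \<Lambda>" "\<zeta> \<in> paths \<Lambda>" "deg \<Lambda> \<mu> = a" "deg \<Lambda> \<zeta> = b + c"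
    "src \<Lambda> \<mu> = rng \<Lambda> \<zeta>" "\<eta> = pcomp \<Lambda> \<mu> \<zeta>"
    using factorisationE[of \<eta>] by metis
  then obtain \<nu> \<beta> where \<nu>: "\<nu> \<in> paths \<Lambda>" "\<beta> \<in> paths \<Lambda>" "deg \<Lambda> \<nu> = b" "deg \<Lambda> \<beta> = c"
    "src \<Lambda> \<nu> = rng \<Lambda> \<beta>" "\<zeta> = pcomp \<Lambda> \<nu> \<beta>"
    using factorisationE[of \<zeta>] by metis
  have r: "src \<Lambda> \<mu> = rng \<Lambda> \<nu>" "src \<Lambda> \<alpha> = rng \<Lambda> \<mu>"
    using \<mu> \<nu> \<alpha> by (simp_all add: rng_comp)
  have mn: "segment \<Lambda> \<xi> m n = \<mu>"
    by (rule segment_eqI[of \<alpha> \<mu> \<zeta>]) (use \<alpha> \<mu> r n in auto)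
  have mm: "segment \<Lambda> \<xi> m m = rng \<Lambda> \<mu>"
  proof (rule segment_eqI[of \<alpha> "rng \<Lambda> \<mu>" \<eta>])
    have "pcomp \<Lambda> (rng \<Lambda> \<mu>) \<eta> = \<eta>" using rng_left_unit[OF \<alpha>(2)] \<alpha>(5) r by simp
    then show "\<xi> = pcomp \<Lambda> \<alpha> (pcomp \<Lambda> (rng \<Lambda> \<mu>) \<eta>)" using \<alpha>(6) by simp
    show "src \<Lambda> \<alpha> = rng \<Lambda> (rng \<Lambda> \<mu>)" using rng_src[OF \<alpha>(1)] r by simp
    show "src \<Lambda> (rng \<Lambda> \<mu>) = rng \<Lambda> \<eta>" using src_rng[OF \<mu>(1)] \<alpha>(5) r by simp
  qed (use \<alpha> \<mu> in \<open>simp_all add: rng_closed deg_id\<close>)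
  have np: "segment \<Lambda> \<xi> n p = \<nu>"
    by (rule segment_eqI[of "pcomp \<Lambda> \<alpha> \<mu>" \<nu> \<beta>])
      (use \<alpha> \<mu> \<nu> r n p in \<open>auto simp: comp_closed src_comp comp_assoc deg_comp\<close>)
  have nn: "segment \<Lambda> \<xi> n n = rng \<Lambda> \<nu>"
  proof (rule segment_eqI[of "pcomp \<Lambda> \<alpha> \<mu>" "rng \<Lambda> \<nu>" \<zeta>])
    have "pcomp \<Lambda> (rng \<Lambda> \<nu>) \<zeta> = \<zeta>" using rng_left_unit[OF \<mu>(2)] \<mu>(5) r by simp
    then show "\<xi> = pcomp \<Lambda> (pcomp \<Lambda> \<alpha> \<mu>) (pcomp \<Lambda> (rng \<Lambda> \<nu>) \<zeta>)"
      using \<alpha> \<mu> r by (simp add: comp_assoc)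
    show "src \<Lambda> (pcomp \<Lambda> \<alpha> \<mu>) = rng \<Lambda> (rng \<Lambda> \<nu>)"
      using rng_src[OF \<mu>(1)] \<alpha> \<mu> r by (simp add: src_comp)
    show "src \<Lambda> (rng \<Lambda> \<nu>) = rng \<Lambda> \<zeta>" using src_rng[OF \<nu>(1)] \<mu>(5) r by simp
  qed (use \<alpha> \<mu> \<nu> r n in \<open>simp_all add: comp_closed deg_comp rng_closed deg_id\<close>)
  have mp: "segment \<Lambda> \<xi> m p = pcomp \<Lambda> \<mu> \<nu>"
    by (rule segment_eqI[of \<alpha> "pcomp \<Lambda> \<mu> \<nu>" \<beta>])
      (use \<alpha> \<mu> \<nu> r n p in \<open>auto simp: comp_closed src_comp rng_comp comp_assoc deg_comp add.assoc\<close>)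
  show "segment \<Lambda> \<xi> m n \<in> paths \<Lambda>" "deg \<Lambda> (segment \<Lambda> \<xi> m n) = n - m"
    "rng \<Lambda> (segment \<Lambda> \<xi> m n) = segment \<Lambda> \<xi> m m" "src \<Lambda> (segment \<Lambda> \<xi> m n) = segment \<Lambda> \<xi> n n"
    "pcomp \<Lambda> (segment \<Lambda> \<xi> m n) (segment \<Lambda> \<xi> n p) = segment \<Lambda> \<xi> m p"
    using mn mm np nn mp \<mu> r n by simp_all
qed

lemma segment_pcomp:
  assumes \<xi>: "\<xi> \<in> paths \<Lambda>" and \<eta>: "\<eta> \<in> paths \<Lambda>" "src \<Lambda> \<xi> = rng \<Lambda> \<eta>" and "m \<le> n" "n \<le> deg \<Lambda> \<xi>"
  shows "segment \<Lambda> (pcomp \<Lambda> \<xi> \<eta>) m n = segment \<Lambda> \<xi> m n"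
proof -
  obtain a b where n: "n = m + a" and d: "deg \<Lambda> \<xi> = m + (a + b)"
    using assms(4-5) by (auto simp: vec_le_iff_ex_add add.assoc)
  obtain \<alpha> \<kappa> where \<alpha>: "\<alpha> \<in> paths \<Lambda>" "\<kappa> \<in> paths \<Lambda>" "deg \<Lambda> \<alpha> = m" "deg \<Lambda> \<kappa> = a + b"
    "src \<Lambda> \<alpha> = rng \<Lambda> \<kappa>" "\<xi> = pcomp \<Lambda> \<alpha> \<kappa>"
    using factorisationE[OF \<xi> d] by metis
  then obtain \<mu> \<beta> where \<mu>: "\<mu> \<in> paths \<Lambda>" "\<beta> \<in> paths \<Lambda>" "deg \<Lambda> \<mu> = a" "deg \<Lambda> \<beta> = b"
    "src \<Lambda> \<mu> = rng \<Lambda> \<beta>" "\<kappa> = pcomp \<Lambda> \<mu> \<beta>"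
    using factorisationE[of \<kappa>] by metis
  have r: "src \<Lambda> \<alpha> = rng \<Lambda> \<mu>" "src \<Lambda> \<beta> = rng \<Lambda> \<eta>"
    using \<alpha> \<mu> \<eta> by (simp_all add: rng_comp src_comp)
  have "segment \<Lambda> \<xi> m n = \<mu>"
    by (rule segment_eqI[of \<alpha> \<mu> \<beta>]) (use \<alpha> \<mu> r n in auto)
  moreover have "segment \<Lambda> (pcomp \<Lambda> \<xi> \<eta>) m n = \<mu>"
    by (rule segment_eqI[of \<alpha> \<mu> "pcomp \<Lambda> \<beta> \<eta>"])
      (use \<alpha> \<mu> \<eta> r n in \<open>auto simp: comp_closed rng_comp src_comp comp_assoc\<close>)
  ultimately show ?thesis by simp
qed

lemma segment_full: "\<xi> \<in> paths \<Lambda> \<Longrightarrow> segment \<Lambda> \<xi> 0 (deg \<Lambda> \<xi>) = \<xi>"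
  by (rule segment_eqI[of "rng \<Lambda> \<xi>" \<xi> "src \<Lambda> \<xi>"])
    (auto simp: rng_closed src_closed src_rng rng_src deg_id rng_left_unit src_right_unit)

section \<open>Infinite paths and their initial segments\<close>

lemma infinite_paths_iff:
  "x \<in> infinite_paths \<Lambda> \<longleftrightarrow> x \<in> extensional {(m, n). m \<le> n} \<and>
     (\<forall>m n. m \<le> n \<longrightarrow> x (m, n) \<in> paths \<Lambda> \<and> rng \<Lambda> (x (m, n)) = x (m, m) \<and>
        src \<Lambda> (x (m, n)) = x (n, n) \<and> deg \<Lambda> (x (m, n)) = n - m) \<and>
     (\<forall>m n p. m \<le> n \<longrightarrow> n \<le> p \<longrightarrow> x (m, p) = pcomp \<Lambda> (x (m, n)) (x (n, p)))"
  unfolding infinite_paths_def degree_preserving_functors_def Omega_def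
  by (simp add: PiE_def Pi_def Ball_def split_paired_All) (intro iffI; metis)

context
  fixes x assumes x: "x \<in> infinite_paths \<Lambda>"
begin

lemma infinite_path_closed: "m \<le> n \<Longrightarrow> x (m, n) \<in> paths \<Lambda>"
  and infinite_path_rng: "m \<le> n \<Longrightarrow> rng \<Lambda> (x (m, n)) = x (m, m)"
  and infinite_path_src: "m \<le> n \<Longrightarrow> src \<Lambda> (x (m, n)) = x (n, n)"
  and infinite_path_deg: "m \<le> n \<Longrightarrow> deg \<Lambda> (x (m, n)) = n - m"
  and infinite_path_comp: "m \<le> n \<Longrightarrow> n \<le> p \<Longrightarrow> x (m, p) = pcomp \<Lambda> (x (m, n)) (x (n, p))"
  and infinite_path_undefined: "\<not> m \<le> n \<Longrightarrow> x (m, n) = undefined"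
  using x unfolding infinite_paths_iff extensional_def by blast+

lemmas infinite_path_simps = infinite_path_closed infinite_path_rng infinite_path_src infinite_path_deg

lemma segment_infinite_path:
  assumes "m \<le> n" "n \<le> l"
  shows "segment \<Lambda> (x (0, l)) m n = x (m, n)"
proof (rule segment_eqI[of "x (0, m)" "x (m, n)" "x (n, l)"])
  have ml: "m \<le> l" using assms by (rule order_trans)
  show "x (0, l) = pcomp \<Lambda> (x (0, m)) (pcomp \<Lambda> (x (m, n)) (x (n, l)))"
    using infinite_path_comp[OF assms] infinite_path_comp[OF vec_zero_le ml] by simp
  show "m = deg \<Lambda> (x (0, m))" by (simp add: infinite_path_deg vec_zero_le)
  show "n = deg \<Lambda> (x (0, m)) + deg \<Lambda> (x (m, n))"
    using assms by (simp add: infinite_path_deg vec_zero_le vec_add_diff)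
qed (use assms in \<open>simp_all add: infinite_path_simps vec_zero_le\<close>)

lemma shift_apply: "m \<le> n \<Longrightarrow> shift p x (m, n) = x (p + m, p + n)"
  by (simp add: shift_def Omega_def add.commute)

lemma shift_closed: "shift p x \<in> infinite_paths \<Lambda>"
  unfolding infinite_paths_iff
proof (intro conjI allI impI)
  show "shift p x \<in> extensional {(m, n). m \<le> n}"
    by (simp add: shift_def Omega_def)
next
  fix m n :: "nat ^ 'k" assume mn: "m \<le> n"
  note pmn = vec_add_mono(1)[OF mn, of p]
  show "shift p x (m, n) \<in> paths \<Lambda>" "rng \<Lambda> (shift p x (m, n)) = shift p x (m, m)"
    "src \<Lambda> (shift p x (m, n)) = shift p x (n, n)" "deg \<Lambda> (shift p x (m, n)) = n - m"
    using mn by (simp_all add: shift_apply infinite_path_simps[OF pmn])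
next
  fix m n l :: "nat ^ 'k" assume mn: "m \<le> n" and nl: "n \<le> l"
  show "shift p x (m, l) = pcomp \<Lambda> (shift p x (m, n)) (shift p x (n, l))"
    unfolding shift_apply[OF mn] shift_apply[OF nl] shift_apply[OF order_trans[OF mn nl]]
    by (intro infinite_path_comp vec_add_mono mn nl)
qed

lemma shift_shift: "shift p (shift q x) = shift (q + p) x"
  unfolding shift_def Omega_def by (rule ext) (auto simp: less_eq_vec_def ac_simps)

end

text \<open>The value at \<open>(m, n)\<close> is a segment of \<open>x(0, l)\<close> as soon as \<open>n \<le> l\<close>, so agreement on a cofinal
  set of initial segments suffices.\<close>

lemma infinite_path_eqI:
  assumes "x \<in> infinite_paths \<Lambda>" "y \<in> infinite_paths \<Lambda>"
    and "\<And>n. \<exists>l\<ge>n. x (0, l) = y (0, l)"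
  shows "x = y"
proof
  fix q :: "(nat ^ 'k) \<times> (nat ^ 'k)"
  obtain m n where q: "q = (m, n)" by (cases q)
  show "x q = y q"
  proof (cases "m \<le> n")
    case True
    then show ?thesis
      unfolding q using assms segment_infinite_path by metis
  qed (simp add: q assms infinite_path_undefined)
qed

text \<open>The value at \<open>(m, n)\<close> is the segment between \<open>m\<close> and \<open>n\<close> of any member of the chain that is
  long enough: lengthening a path does not change its segments.\<close>

lemma infinite_path_of_chain:
  fixes \<xi> :: "nat \<Rightarrow> 'a"
  assumes \<xi>: "\<And>j. \<xi> j \<in> paths \<Lambda>"
    and ext: "\<And>j. \<exists>\<eta>\<in>paths \<Lambda>. src \<Lambda> (\<xi> j) = rng \<Lambda> \<eta> \<and> \<xi> (Suc j) = pcomp \<Lambda> (\<xi> j) \<eta>"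
    and cofinal: "\<And>n. \<exists>j. n \<le> deg \<Lambda> (\<xi> j)"
  obtains x where "x \<in> infinite_paths \<Lambda>" "\<And>j. x (0, deg \<Lambda> (\<xi> j)) = \<xi> j"
proof -
  have deg_step: "deg \<Lambda> (\<xi> j) \<le> deg \<Lambda> (\<xi> (Suc j))" for j
    using ext[of j] \<xi> by (auto simp: deg_comp vec_le_add)
  have seg_step: "segment \<Lambda> (\<xi> (Suc j)) m n = segment \<Lambda> (\<xi> j) m n"
    if "m \<le> n" "n \<le> deg \<Lambda> (\<xi> j)" for m n j
    using ext[of j] \<xi> that by (auto simp: segment_pcomp)
  have "deg \<Lambda> (\<xi> j) \<le> deg \<Lambda> (\<xi> i) \<and>
      (\<forall>m n. m \<le> n \<longrightarrow> n \<le> deg \<Lambda> (\<xi> j) \<longrightarrow> segment \<Lambda> (\<xi> i) m n = segment \<Lambda> (\<xi> j) m n)"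
    if "j \<le> i" for i j
    using that
  proof (induction i rule: dec_induct)
    case (step i)
    then show ?case using deg_step[of i] seg_step[of _ _ i] by (metis order_trans)
  qed simp
  note stable = this[THEN conjunct1] this[THEN conjunct2, rule_format]
  have indep: "segment \<Lambda> (\<xi> i) m n = segment \<Lambda> (\<xi> j) m n"
    if "m \<le> n" "n \<le> deg \<Lambda> (\<xi> i)" "n \<le> deg \<Lambda> (\<xi> j)" for i j m n
    using that stable(2)[of i j m n] stable(2)[of j i m n] by (cases "i \<le> j") auto
  define J where "J n = (SOME j. n \<le> deg \<Lambda> (\<xi> j))" for n
  have J: "n \<le> deg \<Lambda> (\<xi> (J n))" for n
    unfolding J_def using cofinal by (rule someI_ex)
  define x where "x = (\<lambda>(m, n) \<in> {(m, n). m \<le> n}. segment \<Lambda> (\<xi> (J n)) m n)"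
  have x_eq: "x (m, n) = segment \<Lambda> (\<xi> j) m n" if "m \<le> n" "n \<le> deg \<Lambda> (\<xi> j)" for m n j
    using indep[OF that(1) J that(2)] that(1) by (simp add: x_def)
  have "x \<in> infinite_paths \<Lambda>"
    unfolding infinite_paths_iff
  proof (intro conjI allI impI)
    show "x \<in> extensional {(m, n). m \<le> n}" by (simp add: x_def)
  next
    fix m n :: "nat ^ 'k" assume mn: "m \<le> n"
    note n = J[of n]
    have eqs: "x (m, n) = segment \<Lambda> (\<xi> (J n)) m n" "x (m, m) = segment \<Lambda> (\<xi> (J n)) m m"
      "x (n, n) = segment \<Lambda> (\<xi> (J n)) n n"
      by (fact x_eq[OF mn n] x_eq[OF order_refl order_trans[OF mn n]] x_eq[OF order_refl n])+
    note seg = segment_functorial[OF \<xi> mn order_refl n]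
    show "x (m, n) \<in> paths \<Lambda>" "rng \<Lambda> (x (m, n)) = x (m, m)" "src \<Lambda> (x (m, n)) = x (n, n)"
      "deg \<Lambda> (x (m, n)) = n - m"
      unfolding eqs by (fact seg)+
  next
    fix m n p :: "nat ^ 'k" assume mn: "m \<le> n" and np: "n \<le> p"
    note p = J[of p]
    have "x (m, p) = segment \<Lambda> (\<xi> (J p)) m p" "x (m, n) = segment \<Lambda> (\<xi> (J p)) m n"
      "x (n, p) = segment \<Lambda> (\<xi> (J p)) n p"
      by (fact x_eq[OF order_trans[OF mn np] p] x_eq[OF mn order_trans[OF np p]] x_eq[OF np p])+
    then show "x (m, p) = pcomp \<Lambda> (x (m, n)) (x (n, p))"
      using segment_comp[OF \<xi> mn np p] by simp
  qed
  moreover have "x (0, deg \<Lambda> (\<xi> j)) = \<xi> j" for j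
    using x_eq[OF vec_zero_le order_refl, of j] \<xi> by (simp add: segment_full)
  ultimately show ?thesis by (rule that)
qed

section \<open>Prepending a finite path\<close>

lemma infinite_path_eq_by_shift:
  assumes x: "x \<in> infinite_paths \<Lambda>" and y: "y \<in> infinite_paths \<Lambda>"
    and "x (0, d) = y (0, d)" and sh: "shift d x = shift d y"
  shows "x = y"
proof (rule infinite_path_eqI[OF x y])
  fix n :: "nat ^ 'k"
  have "x (d, d + n) = y (d, d + n)"
    using fun_cong[OF sh, of "(0, n)"] by (simp add: shift_apply x y vec_zero_le)
  then have "x (0, d + n) = y (0, d + n)"
    using infinite_path_comp[OF x, of 0 d "d + n"] infinite_path_comp[OF y, of 0 d "d + n"] assms(3)
    by (simp add: vec_zero_le vec_le_add)
  then show "\<exists>l\<ge>n. x (0, l) = y (0, l)" using vec_le_add(2) by blast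
qed

lemma prepend_eqI:
  assumes "y \<in> infinite_paths \<Lambda>" "y (0, deg \<Lambda> \<mu>) = \<mu>" "shift (deg \<Lambda> \<mu>) y = x"
  shows "prepend \<Lambda> \<mu> x = y"
  unfolding prepend_def
proof (rule the_equality)
  show "y \<in> infinite_paths \<Lambda> \<and> y (0, deg \<Lambda> \<mu>) = \<mu> \<and> shift (deg \<Lambda> \<mu>) y = x"
    using assms by blast
  show "z = y" if "z \<in> infinite_paths \<Lambda> \<and> z (0, deg \<Lambda> \<mu>) = \<mu> \<and> shift (deg \<Lambda> \<mu>) z = x" for z
    using that assms by (intro infinite_path_eq_by_shift[of z y "deg \<Lambda> \<mu>"]) simp_all
qed

text \<open>\<open>\<mu>x\<close> exists as the limit of the finite paths \<open>\<mu> x(0, n)\<close>, with \<open>n\<close> running through the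
  constant tuples; their degrees are cofinal.\<close>

lemma prepend_works:
  assumes \<mu>: "\<mu> \<in> paths \<Lambda>" and "x \<in> infinite_paths_to \<Lambda> (src \<Lambda> \<mu>)"
  shows prepend_closed: "prepend \<Lambda> \<mu> x \<in> infinite_paths \<Lambda>"
    and prepend_initial: "prepend \<Lambda> \<mu> x (0, deg \<Lambda> \<mu>) = \<mu>"
    and shift_prepend: "shift (deg \<Lambda> \<mu>) (prepend \<Lambda> \<mu> x) = x"
proof -
  have x: "x \<in> infinite_paths \<Lambda>" and x0: "x (0, 0) = src \<Lambda> \<mu>"
    using assms by (auto simp: infinite_paths_to_def)
  define c :: "nat \<Rightarrow> nat ^ 'k" where "c j = (\<chi> i. j)" for j
  have c_mono: "c j \<le> c (Suc j)" for j by (simp add: c_def less_eq_vec_def)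
  have c_cofinal: "\<exists>j. n \<le> c j" for n
  proof -
    have "n $ i \<le> (\<Sum>i\<in>UNIV. n $ i)" for i by (rule member_le_sum) auto
    then show ?thesis by (auto simp: c_def less_eq_vec_def)
  qed
  note xs = infinite_path_simps[OF x] vec_zero_le
  let ?\<xi> = "\<lambda>j. pcomp \<Lambda> \<mu> (x (0, c j))"
  have \<xi>: "?\<xi> j \<in> paths \<Lambda>" "deg \<Lambda> (?\<xi> j) = deg \<Lambda> \<mu> + c j" for j
    using \<mu> x0 by (simp_all add: xs comp_closed deg_comp)
  obtain y where y: "y \<in> infinite_paths \<Lambda>" and "\<And>j. y (0, deg \<Lambda> (?\<xi> j)) = ?\<xi> j"
  proof (rule infinite_path_of_chain[of ?\<xi>])
    show "\<exists>\<eta>\<in>paths \<Lambda>. src \<Lambda> (?\<xi> j) = rng \<Lambda> \<eta> \<and> ?\<xi> (Suc j) = pcomp \<Lambda> (?\<xi> j) \<eta>" for j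
    proof (intro bexI conjI)
      show "?\<xi> (Suc j) = pcomp \<Lambda> (?\<xi> j) (x (c j, c (Suc j)))"
        using \<mu> x0 c_mono infinite_path_comp[OF x vec_zero_le c_mono]
        by (simp add: xs comp_assoc)
    qed (use \<mu> x0 c_mono in \<open>simp_all add: xs src_comp\<close>)
    show "\<exists>j. n \<le> deg \<Lambda> (?\<xi> j)" for n
      using c_cofinal[of n] vec_le_add(2) unfolding \<xi>(2) by (meson order_trans)
  qed (use \<xi> in auto)
  then have y_init: "y (0, deg \<Lambda> \<mu> + c j) = pcomp \<Lambda> \<mu> (x (0, c j))" for j by (simp add: \<xi>)
  have "c 0 = 0" by (simp add: c_def vec_eq_iff)
  then have y\<mu>: "y (0, deg \<Lambda> \<mu>) = \<mu>"
    using y_init[of 0] \<mu> by (simp add: x0 src_right_unit)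
  note ys = infinite_path_simps[OF y] vec_zero_le vec_le_add
  have "shift (deg \<Lambda> \<mu>) y (0, c j) = x (0, c j)" for j
  proof -
    have "src \<Lambda> \<mu> = y (deg \<Lambda> \<mu>, deg \<Lambda> \<mu>)"
      using infinite_path_src[OF y vec_zero_le, of "deg \<Lambda> \<mu>"] y\<mu> by simp
    moreover have "pcomp \<Lambda> \<mu> (y (deg \<Lambda> \<mu>, deg \<Lambda> \<mu> + c j)) = pcomp \<Lambda> \<mu> (x (0, c j))"
      using infinite_path_comp[OF y vec_zero_le vec_le_add(1), of "deg \<Lambda> \<mu>" "c j"] y\<mu> y_init[of j]
      by simp
    ultimately have "y (deg \<Lambda> \<mu>, deg \<Lambda> \<mu> + c j) = x (0, c j)"
      using \<mu> x0 by - (rule composite_eqD(2)[of \<mu> _ \<mu>], simp_all add: ys xs)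
    then show ?thesis by (simp add: shift_apply y vec_zero_le)
  qed
  then have "shift (deg \<Lambda> \<mu>) y = x"
    using c_cofinal by (intro infinite_path_eqI shift_closed y x) blast
  then have "prepend \<Lambda> \<mu> x = y" "shift (deg \<Lambda> \<mu>) y = x" using prepend_eqI y y\<mu> by blast+
  then show "prepend \<Lambda> \<mu> x \<in> infinite_paths \<Lambda>" "prepend \<Lambda> \<mu> x (0, deg \<Lambda> \<mu>) = \<mu>"
    "shift (deg \<Lambda> \<mu>) (prepend \<Lambda> \<mu> x) = x"
    using y y\<mu> by simp_all
qed

section \<open>The equivalence of the aperiodicity conditions\<close>

text \<open>This is the property required of a path in (iv).\<close>

definition distinguishes :: "'a \<Rightarrow> nat ^ 'k \<Rightarrow> nat ^ 'k \<Rightarrow> bool" where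
  "distinguishes \<xi> m n \<longleftrightarrow> vmax m n \<le> deg \<Lambda> \<xi> \<and>
     segment \<Lambda> \<xi> m (m + deg \<Lambda> \<xi> - vmax m n) \<noteq> segment \<Lambda> \<xi> n (n + deg \<Lambda> \<xi> - vmax m n)"

text \<open>The degrees that are at least \<open>vmax m n\<close> are those of the form \<open>vmax m n + q\<close>, and in this form the
  subtractions in \<open>distinguishes\<close> cancel: what is compared is the pair of segments of degree \<open>q\<close>
  starting at \<open>m\<close> and at \<open>n\<close>.\<close>

lemma distinguishes_initial_iff:
  assumes x: "x \<in> infinite_paths \<Lambda>"
  shows "distinguishes (x (0, vmax m n + q)) m n \<longleftrightarrow> x (m, m + q) \<noteq> x (n, n + q)"
proof -
  have "m + q \<le> vmax m n + q" "n + q \<le> vmax m n + q"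
    by (simp_all add: vec_add_mono le_vmax)
  moreover have "m + (vmax m n + q) - vmax m n = m + q" "n + (vmax m n + q) - vmax m n = n + q"
    by (simp_all add: vec_eq_iff)
  ultimately show ?thesis
    using x by (simp add: distinguishes_def infinite_path_deg segment_infinite_path vec_zero_le vec_le_add)
qed

lemma condition_B_if_aperiodic:
  assumes "aperiodicity_condition \<Lambda>"
  shows "condition_B \<Lambda>"
  unfolding condition_B_def
proof
  fix v assume "v \<in> vertices \<Lambda>"
  then obtain x where xv: "x \<in> infinite_paths_to \<Lambda> v" and ap: "\<And>m n. m \<noteq> n \<Longrightarrow> shift m x \<noteq> shift n x"
    using assms by (auto simp: aperiodicity_condition_def)
  have "\<mu> = \<nu>" if "\<mu> \<in> paths_from \<Lambda> (paths \<Lambda>) v" "\<nu> \<in> paths_from \<Lambda> (paths \<Lambda>) v"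
    and eq: "prepend \<Lambda> \<mu> x = prepend \<Lambda> \<nu> x" for \<mu> \<nu>
  proof -
    have p: "\<mu> \<in> paths \<Lambda>" "\<nu> \<in> paths \<Lambda>" and "src \<Lambda> \<mu> = v" "src \<Lambda> \<nu> = v"
      using that by (auto simp: paths_from_def)
    with xv have x\<mu>: "x \<in> infinite_paths_to \<Lambda> (src \<Lambda> \<mu>)" and x\<nu>: "x \<in> infinite_paths_to \<Lambda> (src \<Lambda> \<nu>)"
      by auto
    let ?y = "prepend \<Lambda> \<mu> x"
    note \<mu> = prepend_works[OF p(1) x\<mu>] and \<nu> = prepend_works[OF p(2) x\<nu>, folded eq]
    \<comment> \<open>Read the path \<open>\<mu>x = \<nu>x\<close> from \<open>d(\<mu>) + d(\<nu>)\<close> on, first as \<open>\<mu>x\<close> and then as \<open>\<nu>x\<close>.\<close>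
    have "shift (deg \<Lambda> \<nu>) x = shift (deg \<Lambda> \<mu> + deg \<Lambda> \<nu>) ?y"
      using shift_shift[OF \<mu>(1), of "deg \<Lambda> \<nu>" "deg \<Lambda> \<mu>"] unfolding \<mu>(3) .
    also have "\<dots> = shift (deg \<Lambda> \<mu>) x"
      using shift_shift[OF \<mu>(1), of "deg \<Lambda> \<mu>" "deg \<Lambda> \<nu>"] unfolding \<nu>(3) by (simp add: add.commute)
    finally have "deg \<Lambda> \<mu> = deg \<Lambda> \<nu>" using ap by metis
    with \<mu>(2) \<nu>(2) show ?thesis by metis
  qed
  with xv show "\<exists>x\<in>infinite_paths_to \<Lambda> v. \<forall>\<mu>\<in>paths_from \<Lambda> (paths \<Lambda>) v.
      \<forall>\<nu>\<in>paths_from \<Lambda> (paths \<Lambda>) v. \<mu> \<noteq> \<nu> \<longrightarrow> prepend \<Lambda> \<mu> x \<noteq> prepend \<Lambda> \<nu> x"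
    by blast
qed

lemma no_local_periodicity_if_condition_B:
  assumes "no_sources \<Lambda>" "condition_B \<Lambda>"
  shows "no_local_periodicity \<Lambda>"
  unfolding no_local_periodicity_def
proof (intro ballI allI impI)
  fix v and m n :: "nat ^ 'k" assume v: "v \<in> vertices \<Lambda>" and "m \<noteq> n"
  let ?N = "vmax m n"
  obtain \<xi> where \<xi>: "\<xi> \<in> paths \<Lambda>" "deg \<Lambda> \<xi> = ?N" "rng \<Lambda> \<xi> = v"
    using assms(1) v by (auto simp: no_sources_def paths_to_def paths_of_degree_def)
  have "src \<Lambda> \<xi> \<in> vertices \<Lambda>"
    unfolding vertices_eq_identities using \<xi> by (metis imageI rng_src src_closed)
  with assms(2) obtain x where x: "x \<in> infinite_paths_to \<Lambda> (src \<Lambda> \<xi>)"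
    and B: "\<And>\<mu> \<nu>. \<mu> \<in> paths_from \<Lambda> (paths \<Lambda>) (src \<Lambda> \<xi>) \<Longrightarrow> \<nu> \<in> paths_from \<Lambda> (paths \<Lambda>) (src \<Lambda> \<xi>) \<Longrightarrow>
      prepend \<Lambda> \<mu> x = prepend \<Lambda> \<nu> x \<Longrightarrow> \<mu> = \<nu>"
    unfolding condition_B_def by metis
  define y where "y = prepend \<Lambda> \<xi> x"
  note y = prepend_works[OF \<xi>(1) x, folded y_def, unfolded \<xi>(2)]
  note ys = infinite_path_simps[OF y(1)] vec_zero_le
  have y0: "y \<in> infinite_paths_to \<Lambda> v"
    using infinite_path_rng[OF y(1) vec_zero_le, of ?N] y \<xi> by (simp add: infinite_paths_to_def)
  \<comment> \<open>The shift of \<open>y = \<xi>x\<close> by \<open>a\<close> is again a product with \<open>x\<close>, namely of the tail of \<open>\<xi>\<close> from \<open>a\<close>.\<close>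
  have tail: "y (a, ?N) \<in> paths_from \<Lambda> (paths \<Lambda>) (src \<Lambda> \<xi>)" "prepend \<Lambda> (y (a, ?N)) x = shift a y"
    "a + deg \<Lambda> (y (a, ?N)) = ?N" if a: "a \<le> ?N" for a
  proof -
    show "y (a, ?N) \<in> paths_from \<Lambda> (paths \<Lambda>) (src \<Lambda> \<xi>)"
      using a infinite_path_src[OF y(1) vec_zero_le, of ?N] y(2) by (simp add: paths_from_def ys)
    show d: "a + deg \<Lambda> (y (a, ?N)) = ?N" using a by (simp add: ys vec_add_diff)
    show "prepend \<Lambda> (y (a, ?N)) x = shift a y"
      by (rule prepend_eqI) (use y d in \<open>simp_all add: shift_closed shift_apply shift_shift vec_zero_le\<close>)
  qed
  have "shift m y \<noteq> shift n y"
  proof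
    assume "shift m y = shift n y"
    then have "y (m, ?N) = y (n, ?N)" by (intro B) (simp_all add: tail le_vmax)
    with tail(3)[OF le_vmax(1)] tail(3)[OF le_vmax(2)] have "m = n" by (metis add_right_cancel)
    with \<open>m \<noteq> n\<close> show False ..
  qed
  with y0 show "\<exists>x\<in>infinite_paths_to \<Lambda> v. shift m x \<noteq> shift n x" by blast
qed

lemma distinguishing_path_if_no_local_periodicity:
  assumes "no_local_periodicity \<Lambda>" "v \<in> vertices \<Lambda>" "m \<noteq> n"
  shows "\<exists>\<xi>\<in>paths_to \<Lambda> v (paths \<Lambda>). distinguishes \<xi> m n"
proof -
  obtain x where x: "x \<in> infinite_paths \<Lambda>" "x (0, 0) = v" and ne: "shift m x \<noteq> shift n x"
    using assms unfolding no_local_periodicity_def infinite_paths_to_def by blast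
  obtain q where "shift m x (0, q) \<noteq> shift n x (0, q)"
    using infinite_path_eqI[OF shift_closed shift_closed] x(1) ne by blast
  then have "distinguishes (x (0, vmax m n + q)) m n"
    by (simp add: distinguishes_initial_iff shift_apply x vec_zero_le)
  moreover have "x (0, vmax m n + q) \<in> paths_to \<Lambda> v (paths \<Lambda>)"
    using x by (simp add: paths_to_def infinite_path_simps vec_zero_le)
  ultimately show ?thesis by blast
qed

text \<open>The enumeration runs over all pairs, diagonal ones included. At a diagonal pair \<open>(n, n)\<close> there
  is nothing to distinguish, and the stage appends a path of degree \<open>n\<close> instead; since every such
  pair occurs, the degrees of the chain are cofinal.\<close>

lemma aperiodic_if_distinguishing_paths:
  assumes ns: "no_sources \<Lambda>"
    and dist: "\<And>v m n. v \<in> vertices \<Lambda> \<Longrightarrow> m \<noteq> n \<Longrightarrow> \<exists>\<xi>\<in>paths_to \<Lambda> v (paths \<Lambda>). distinguishes \<xi> m n"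
  shows "aperiodicity_condition \<Lambda>"
  unfolding aperiodicity_condition_def
proof
  fix v assume v: "v \<in> vertices \<Lambda>"
  define good where "good \<xi> \<eta> m n \<longleftrightarrow> \<eta> \<in> paths \<Lambda> \<and> src \<Lambda> \<xi> = rng \<Lambda> \<eta> \<and> m \<le> deg \<Lambda> \<eta> \<and>
    (m \<noteq> n \<longrightarrow> distinguishes \<eta> m n)" for \<xi> \<eta> m n
  have ex_good: "\<exists>\<eta>. good \<xi> \<eta> m n" if \<xi>: "\<xi> \<in> paths \<Lambda>" for \<xi> m n
  proof -
    have s: "src \<Lambda> \<xi> \<in> vertices \<Lambda>"
      unfolding vertices_eq_identities using \<xi> by (metis imageI rng_src src_closed)
    show ?thesis
    proof (cases "m = n")
      case True
      obtain \<eta> where "\<eta> \<in> paths_to \<Lambda> (src \<Lambda> \<xi>) (paths_of_degree \<Lambda> n)"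
        using ns s unfolding no_sources_def by blast
      with True show ?thesis by (auto simp: good_def paths_to_def paths_of_degree_def)
    next
      case False
      then obtain \<eta> where "\<eta> \<in> paths_to \<Lambda> (src \<Lambda> \<xi>) (paths \<Lambda>)" "distinguishes \<eta> m n"
        using dist s by blast
      moreover from this have "m \<le> deg \<Lambda> \<eta>"
        using le_vmax(1) by (auto simp: distinguishes_def intro: order_trans)
      ultimately show ?thesis by (auto simp: good_def paths_to_def)
    qed
  qed
  define e where "e = (from_nat :: nat \<Rightarrow> (nat ^ 'k) \<times> (nat ^ 'k))"
  have "\<exists>\<xi>. \<forall>j. (\<xi> j \<in> paths \<Lambda> \<and> (j = 0 \<longrightarrow> \<xi> j = v)) \<and>
    (\<exists>\<eta>. good (\<xi> j) \<eta> (fst (e j)) (snd (e j)) \<and> \<xi> (Suc j) = pcomp \<Lambda> (\<xi> j) \<eta>)"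
  proof (rule dependent_nat_choice)
    show "\<exists>a. a \<in> paths \<Lambda> \<and> (0 = (0::nat) \<longrightarrow> a = v)"
      using v by (auto simp: vertices_def paths_of_degree_def)
    show "\<exists>b. (b \<in> paths \<Lambda> \<and> (Suc j = 0 \<longrightarrow> b = v)) \<and>
        (\<exists>\<eta>. good a \<eta> (fst (e j)) (snd (e j)) \<and> b = pcomp \<Lambda> a \<eta>)"
      if "a \<in> paths \<Lambda> \<and> (j = 0 \<longrightarrow> a = v)" for a j
      using that ex_good[of a "fst (e j)" "snd (e j)"] by (auto simp: good_def intro: comp_closed)
  qed
  then obtain \<xi> where \<xi>: "\<And>j. \<xi> j \<in> paths \<Lambda>" "\<xi> 0 = v"
    and step: "\<And>j. \<exists>\<eta>. good (\<xi> j) \<eta> (fst (e j)) (snd (e j)) \<and> \<xi> (Suc j) = pcomp \<Lambda> (\<xi> j) \<eta>"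
    by metis
  have stage: "\<exists>j \<eta>. good (\<xi> j) \<eta> m n \<and> \<xi> (Suc j) = pcomp \<Lambda> (\<xi> j) \<eta>" for m n
    using step[of "to_nat (m, n)"] unfolding e_def by auto
  obtain x where x: "x \<in> infinite_paths \<Lambda>" and init: "\<And>j. x (0, deg \<Lambda> (\<xi> j)) = \<xi> j"
  proof (rule infinite_path_of_chain[of \<xi>])
    show "\<exists>\<eta>\<in>paths \<Lambda>. src \<Lambda> (\<xi> j) = rng \<Lambda> \<eta> \<and> \<xi> (Suc j) = pcomp \<Lambda> (\<xi> j) \<eta>" for j
      using step[of j] by (auto simp: good_def)
    show "\<exists>j. n \<le> deg \<Lambda> (\<xi> j)" for n
    proof -
      obtain j \<eta> where "good (\<xi> j) \<eta> n n" "\<xi> (Suc j) = pcomp \<Lambda> (\<xi> j) \<eta>" using stage by blast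
      then have "n \<le> deg \<Lambda> (\<xi> (Suc j))"
        using \<xi>(1) vec_le_add(2) by (auto simp: good_def deg_comp intro: order_trans)
      then show ?thesis ..
    qed
  qed (use \<xi> in auto)
  have "x (0, 0) = v"
    using init[of 0] \<xi>(2) v by (simp add: vertices_def paths_of_degree_def)
  moreover have "shift m x \<noteq> shift n x" if "m \<noteq> n" for m n
  proof
    assume eq: "shift m x = shift n x"
    obtain j \<eta> where \<eta>: "\<eta> \<in> paths \<Lambda>" "src \<Lambda> (\<xi> j) = rng \<Lambda> \<eta>" "distinguishes \<eta> m n"
      and Suc: "\<xi> (Suc j) = pcomp \<Lambda> (\<xi> j) \<eta>"
      using stage[of m n] \<open>m \<noteq> n\<close> by (auto simp: good_def)
    \<comment> \<open>The part \<open>z\<close> of \<open>x\<close> built from stage \<open>j\<close> on begins with \<open>\<eta>\<close> and inherits the assumed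
      equality of shifts, which \<open>\<eta>\<close> refutes.\<close>
    define p where "p = deg \<Lambda> (\<xi> j)"
    define z where "z = shift p x"
    have z: "z \<in> infinite_paths \<Lambda>" unfolding z_def using x by (rule shift_closed)
    have "shift m z = shift n z"
      using arg_cong[OF eq, of "shift p"] x by (simp add: shift_shift z_def add.commute)
    obtain q where q: "deg \<Lambda> \<eta> = vmax m n + q"
      using \<eta>(3) by (auto simp: distinguishes_def vec_le_iff_ex_add)
    have "z (0, deg \<Lambda> \<eta>) = x (p, p + deg \<Lambda> \<eta>)"
      using x by (simp add: z_def shift_apply vec_zero_le)
    also have "\<dots> = \<eta>"
    proof (rule composite_eqD(2)[of "\<xi> j" _ "\<xi> j"])
      have "deg \<Lambda> (\<xi> (Suc j)) = p + deg \<Lambda> \<eta>"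
        unfolding Suc p_def using \<xi>(1) \<eta> by (simp add: deg_comp)
      then show "pcomp \<Lambda> (\<xi> j) (x (p, p + deg \<Lambda> \<eta>)) = pcomp \<Lambda> (\<xi> j) \<eta>"
        using infinite_path_comp[OF x vec_zero_le vec_le_add(1), of p "deg \<Lambda> \<eta>"] init[of j]
          init[of "Suc j"] Suc by (simp add: p_def)
      show "src \<Lambda> (\<xi> j) = rng \<Lambda> (x (p, p + deg \<Lambda> \<eta>))"
        using infinite_path_src[OF x vec_zero_le, of p] init[of j]
        by (simp add: p_def infinite_path_rng[OF x] vec_le_add)
    qed (use \<xi> \<eta> in \<open>auto simp: infinite_path_closed[OF x] vec_le_add\<close>)
    finally have "z (m, m + q) \<noteq> z (n, n + q)"
      using distinguishes_initial_iff[OF z] \<eta>(3) q by metis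
    with fun_cong[OF \<open>shift m z = shift n z\<close>, of "(0, q)"] show False
      by (simp add: shift_apply z vec_zero_le)
  qed
  ultimately show "\<exists>x\<in>infinite_paths_to \<Lambda> v. \<forall>m n. m \<noteq> n \<longrightarrow> shift m x \<noteq> shift n x"
    using x by (auto simp: infinite_paths_to_def)
qed

end

theorem lemma3p2:
  fixes \<Lambda> :: "('a, 'k::finite) kgraph"
  assumes "k_graph \<Lambda>" and "row_finite \<Lambda>" and "no_sources \<Lambda>"
  shows "(aperiodicity_condition \<Lambda> \<longleftrightarrow> condition_B \<Lambda>) \<and>
         (condition_B \<Lambda> \<longleftrightarrow> no_local_periodicity \<Lambda>) \<and>
         (no_local_periodicity \<Lambda> \<longleftrightarrow>
           (\<forall>v \<in> vertices \<Lambda>. \<forall>m n. m \<noteq> n \<longrightarrow>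
             (\<exists>\<xi> \<in> paths_to \<Lambda> v (paths \<Lambda>). vmax m n \<le> deg \<Lambda> \<xi> \<and>
                segment \<Lambda> \<xi> m (m + deg \<Lambda> \<xi> - vmax m n) \<noteq>
                segment \<Lambda> \<xi> n (n + deg \<Lambda> \<xi> - vmax m n))))"
proof -
  interpret k_graph \<Lambda> by (fact assms)
  show ?thesis
    unfolding distinguishes_def[symmetric]
    using condition_B_if_aperiodic no_local_periodicity_if_condition_B[OF assms(3)]
      distinguishing_path_if_no_local_periodicity aperiodic_if_distinguishing_paths[OF assms(3)]
    by blast
qed

end
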